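(* Let $t\in\{0,\dots,T-1\}$ and $n\in\mathcal N'_t$, and let the numbers $\pi(m,n)\ge 0$, $m\in\mathcal N_t$, be fixed. Then the recursive problem $$ \begin{array}{lll} \displaystyle\min_{\pi(\cdot,\cdot|\cdot,n)} & \displaystyle\sum_{m\in\mathcal N_t}\pi(m,n)\sum_{i\in m+,\ j\in n+}\pi(i,j|m,n)\,\delta_\iota(i,j) & \\[1ex] \text{s.t.} & \displaystyle\sum_{j\in n+}\pi(i,j|m,n)=P(i|m), & m\in\mathcal N_t,\ i\in m+,\\[1ex] & \displaystyle\sum_{i\in m+}\pi(i,j|m,n)=\sum_{i\in\tilde m+}\pi(i,j|\tilde m,n), & j\in n+,\ m,\tilde m\in\mathcal N_t,\\[1ex] & \pi(i,j|m,n)\ge 0, & m\in\mathcal N_t,\ i\in m+,\ j\in n+, \end{array} $$ whose variables are the numbers $\pi(i,j|m,n)$ for $m\in\mathcal N_t$, $i\in m+$, $j\in n+$, is a Wasserstein barycenter problem. Precisely, with weights $\alpha^n_m:=\pi(m,n)$, it is equivalent to $$ \min_{P'(\cdot|n)\ge 0}\ \sum_{m\in\mathcal N_t}\alpha^n_m\,W_\iota^\iota\Big((P'(j|n))_{j\in n+},\,(P(i|m))_{i\in m+}\Big)\quad\text{s.t.}\quad \sum_{j\in n+}P'(j|n)=1, $$ in the sense that the two problems have the same optimal value and that a probability vector $(P'(j|n))_{j\in n+}$ solves the second problem if and only if it is the common marginal $P'(j|n)=\sum_{i\in m+}\pi(i,j|m,n)$ ($j\in n+$, independent of $m\in\mathcal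 N_t$) of some optimal solution $\pi(\cdot,\cdot|\cdot,n)$ of the first problem.
   Context: Two finite rooted trees of depth $T$ (stages $0,1,\dots,T$) are given: an original scenario tree with node set $\mathcal N$ and a reduced scenario tree with node set $\mathcal N'$. $\mathcal N_t$ and $\mathcal N'_t$ denote the sets of nodes at stage $t$; all leaves are at stage $T$. For a node $m$, $m+$ denotes the set of its direct successors (children), which is nonempty for every node at a stage $<T$. The original tree carries node probabilities $P(m)>0$ with $P(m)=\sum_{i\in m+}P(i)$ for every non-leaf node $m$, and $\sum_{m\in\mathcal N_T}P(m)=1$. Conditional probabilities are $P(i|m)=P(i)/P(m)$ for $i\in m+$, so that $\sum_{i\in m+}P(i|m)=1$. Costs: $\iota\in[1,\infty)$ is fixed. For leaves $i\in\mathcal N_T$, $j\in\mathcal N'_T$, $\delta_\iota(i,j)=\mathtt d_{i,j}^{\,\iota}$, where $\mathtt d_{i,j}\ge0$ is the given distance between the scenarios (root-to-leaf paths of values) ending at $i$ and $j$. For $m\in\mathcal N_s$, $n\in\mathcal N'_s$ with $s<T$, one sets recursively $\delta_\iota(m,n)=\sum_{i\in m+,\,j\in n+}\pi(i,j|m,n)\,\delta_\iota(i,j)$. In the problem at stage $t$, the costs $\delta_\iota(i,j)\ge 0$ for $i\in\mathcal N_{t+1}$, $j\in\mathcal N'_{t+1}$ are already computed (using nonnegative conditional transport plans fixed at stages later than $t$), so they are given constants. Wasserstein cost: for probability vectors $p=(p_j)_{j\in n+}$ and $q=(q_i)_{i\in m+}$, $W_\iota^\iota(p,q)$ denotes the optimal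 transport cost with ground cost $\delta_\iota(i,j)$, namely $$W_\iota^\iota(p,q)=\min\Big\{\sum_{i\in m+,\,j\in n+}\delta_\iota(i,j)\,\pi_{ij}\ :\ \pi_{ij}\ge0,\ \sum_{j\in n+}\pi_{ij}=q_i\ \ \forall i\in m+,\ \sum_{i\in m+}\pi_{ij}=p_j\ \ \forall j\in n+\Big\}.$$ A Wasserstein barycenter problem for finitely many given discrete probability measures $\nu^m$ with nonnegative weights $\alpha_m$ is the problem of minimizing $\sum_m\alpha_m W_\iota^\iota(\mu,\nu^m)$ over probability measures $\mu$; here $\mu$ has fixed finite support indexed by $n+$, so that the minimization is over its probability vector. *)

theory Defs
  imports Complex_Main
begin

text \<open>A finite rooted tree is given by its nodes \<open>V\<close>, its edges \<open>E\<close> (directed from a node to its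
  direct successors) and its root \<open>r\<close>.\<close>

definition children :: "('a \<times> 'a) set \<Rightarrow> 'a \<Rightarrow> 'a set" where
  "children E m = {i. (m, i) \<in> E}"

definition stage :: "('a \<times> 'a) set \<Rightarrow> 'a \<Rightarrow> nat \<Rightarrow> 'a set" where
  "stage E r t = {m. (r, m) \<in> E ^^ t}"

locale rooted_tree =
  fixes V :: "'a set" and E :: "('a \<times> 'a) set" and r :: 'a
  assumes finite_nodes: "finite V"
    and edges: "E \<subseteq> V \<times> V"
    and root_node: "r \<in> V"
    and root_no_parent: "\<And>m. (m, r) \<notin> E"
    and unique_parent: "\<And>i. i \<in> V \<Longrightarrow> i \<noteq> r \<Longrightarrow> \<exists>!m. (m, i) \<in> E"
    and reachable: "\<And>m. m \<in> V \<Longrightarrow> (r, m) \<in> E\<^sup>*"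

text \<open>The leaves are exactly the nodes at stage \<open>T\<close>; hence there are no stages beyond \<open>T\<close> and every
  node at an earlier stage has a child.\<close>

locale depth_tree = rooted_tree V E r
  for V :: "'a set" and E :: "('a \<times> 'a) set" and r :: 'a +
  fixes T :: nat
  assumes leaf_iff: "\<And>m. m \<in> V \<Longrightarrow> children E m = {} \<longleftrightarrow> m \<in> stage E r T"

locale scenario_tree = depth_tree V E r T
  for V :: "'a set" and E :: "('a \<times> 'a) set" and r :: 'a and T :: nat +
  fixes P :: "'a \<Rightarrow> real"
  assumes prob_pos: "\<And>m. m \<in> V \<Longrightarrow> P m > 0"
    and prob_children: "\<And>m. m \<in> V \<Longrightarrow> children E m \<noteq> {} \<Longrightarrow> P m = (\<Sum>i\<in>children E m. P i)"
    and prob_leaves: "(\<Sum>m\<in>stage E r T. P m) = 1"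

definition cond_prob :: "('a \<Rightarrow> real) \<Rightarrow> 'a \<Rightarrow> 'a \<Rightarrow> real" where
  "cond_prob P m i = P i / P m"

text \<open>\<open>node_cost E E' d \<iota> \<kappa> k m n\<close> is the cost \<open>\<delta>\<^sub>\<iota>(m, n)\<close> of nodes \<open>m\<close>, \<open>n\<close> lying \<open>k\<close> levels above the
  leaves, i.e. at stage \<open>T - k\<close>. Here \<open>\<kappa> m n i j\<close> stands for the conditional plan \<open>\<pi>(i, j | m, n)\<close>.
  For \<open>k\<close> levels, only the plans at the stages \<open>T - k, \<dots>, T - 1\<close> enter.\<close>

primrec node_cost :: "('a \<times> 'a) set \<Rightarrow> ('b \<times> 'b) set \<Rightarrow> ('a \<Rightarrow> 'b \<Rightarrow> real) \<Rightarrow> real \<Rightarrow>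
    ('a \<Rightarrow> 'b \<Rightarrow> 'a \<Rightarrow> 'b \<Rightarrow> real) \<Rightarrow> nat \<Rightarrow> 'a \<Rightarrow> 'b \<Rightarrow> real" where
  "node_cost E E' d \<iota> \<kappa> 0 = (\<lambda>i j. d i j powr \<iota>)"
| "node_cost E E' d \<iota> \<kappa> (Suc k) =
     (\<lambda>m n. \<Sum>i\<in>children E m. \<Sum>j\<in>children E' n. \<kappa> m n i j * node_cost E E' d \<iota> \<kappa> k i j)"

text \<open>Vectors and plans on finite index sets are functions whose values off the index sets are
  irrelevant.\<close>

definition prob_vector :: "'b set \<Rightarrow> ('b \<Rightarrow> real) \<Rightarrow> bool" where
  "prob_vector B p \<longleftrightarrow> (\<forall>j\<in>B. p j \<ge> 0) \<and> (\<Sum>j\<in>B. p j) = 1"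

definition transport_plans ::
    "'a set \<Rightarrow> 'b set \<Rightarrow> ('b \<Rightarrow> real) \<Rightarrow> ('a \<Rightarrow> real) \<Rightarrow> ('a \<Rightarrow> 'b \<Rightarrow> real) set" where
  "transport_plans A B p q = {\<pi>. (\<forall>i\<in>A. \<forall>j\<in>B. \<pi> i j \<ge> 0) \<and>
     (\<forall>i\<in>A. (\<Sum>j\<in>B. \<pi> i j) = q i) \<and> (\<forall>j\<in>B. (\<Sum>i\<in>A. \<pi> i j) = p j)}"

text \<open>\<open>W\<^sub>\<iota>\<^sup>\<iota>(p, q)\<close> with ground cost \<open>c\<close> (already including the power \<open>\<iota>\<close>). For probability vectors on finite
  index sets the infimum is a minimum.\<close>

definition wasserstein_pow ::
    "'a set \<Rightarrow> 'b set \<Rightarrow> ('a \<Rightarrow> 'b \<Rightarrow> real) \<Rightarrow> ('b \<Rightarrow> real) \<Rightarrow> ('a \<Rightarrow> real) \<Rightarrow> real" where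
  "wasserstein_pow A B c p q =
     (INF \<pi>\<in>transport_plans A B p q. \<Sum>i\<in>A. \<Sum>j\<in>B. c i j * \<pi> i j)"

text \<open>Barycenter problem for measures \<open>\<nu> m\<close>, supported on \<open>A m\<close>, with weights \<open>\<alpha> m\<close>, over measures with
  fixed finite support \<open>B\<close>: minimize this objective over all \<open>p\<close> with \<open>prob_vector B p\<close>.\<close>

definition barycenter_objective :: "'m set \<Rightarrow> ('m \<Rightarrow> 'a set) \<Rightarrow> 'b set \<Rightarrow> ('a \<Rightarrow> 'b \<Rightarrow> real) \<Rightarrow>
    ('m \<Rightarrow> real) \<Rightarrow> ('m \<Rightarrow> 'a \<Rightarrow> real) \<Rightarrow> ('b \<Rightarrow> real) \<Rightarrow> real" where
  "barycenter_objective M A B c \<alpha> \<nu> p = (\<Sum>m\<in>M. \<alpha> m * wasserstein_pow (A m) B c p (\<nu> m))"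

text \<open>The recursive problem at a node \<open>n\<close> of the reduced tree, with \<open>M\<close> the nodes of the same stage in
  the original tree, \<open>B = n+\<close>, and \<open>\<pi> m i j\<close> standing for \<open>\<pi>(i, j | m, n)\<close>.\<close>

definition recursive_feasible ::
    "('a \<times> 'a) set \<Rightarrow> ('a \<Rightarrow> real) \<Rightarrow> 'a set \<Rightarrow> 'b set \<Rightarrow> ('a \<Rightarrow> 'a \<Rightarrow> 'b \<Rightarrow> real) \<Rightarrow> bool" where
  "recursive_feasible E P M B \<pi> \<longleftrightarrow>
     (\<forall>m\<in>M. \<forall>i\<in>children E m. (\<Sum>j\<in>B. \<pi> m i j) = cond_prob P m i) \<and>
     (\<forall>j\<in>B. \<forall>m\<in>M. \<forall>m'\<in>M. (\<Sum>i\<in>children E m. \<pi> m i j) = (\<Sum>i\<in>children E m'. \<pi> m' i j)) \<and>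
     (\<forall>m\<in>M. \<forall>i\<in>children E m. \<forall>j\<in>B. \<pi> m i j \<ge> 0)"

definition recursive_objective :: "('a \<times> 'a) set \<Rightarrow> 'a set \<Rightarrow> 'b set \<Rightarrow> ('a \<Rightarrow> 'b \<Rightarrow> real) \<Rightarrow>
    ('a \<Rightarrow> real) \<Rightarrow> ('a \<Rightarrow> 'a \<Rightarrow> 'b \<Rightarrow> real) \<Rightarrow> real" where
  "recursive_objective E M B c \<alpha> \<pi> =
     (\<Sum>m\<in>M. \<alpha> m * (\<Sum>i\<in>children E m. \<Sum>j\<in>B. \<pi> m i j * c i j))"

end

theory Submission
  imports Defs "HOL-Analysis.Function_Topology"
begin

text \<open>Why the two problems agree: a family of conditional plans \<open>\<pi>(\<cdot>, \<cdot> | m, n)\<close> is feasible for the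
  recursive problem exactly if all its members are transport plans to one and the same probability
  vector \<open>p\<close> on \<open>n+\<close> (\<open>recursive_feasible_iff\<close>). So the recursive problem is a joint minimization over
  \<open>p\<close> and over plans with second marginal \<open>p\<close>. For a fixed \<open>p\<close> the plans of different nodes \<open>m\<close> are
  not coupled any more, and since the weights are nonnegative, the weighted sum of their costs is
  minimal if each plan is optimal. The minimal value is the barycenter objective at \<open>p\<close>. In other
  words, the barycenter objective is the partial minimum of the recursive objective: it is a lower
  bound (\<open>barycenter_le_recursive\<close>) that is attained by some family with marginal \<open>p\<close>
  (\<open>barycenter_attained\<close>).

  Both minima exist because the plans restricted to their finite index sets form compact sets, on
  which the linear objectives are continuous. The assertion on the solution sets then follows by
  comparing values. The trees supply the finite nonempty index sets: a node of stage \<open>t < T\<close> is not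
  also at stage \<open>T\<close>, so it has a child, and the conditional probabilities of its children add up
  to 1.\<close>

section \<open>Existence of optimal transport plans\<close>

text \<open>Tychonoff's theorem for the pointwise topology. Curried arrays of reals are covered by
  applying it once for every argument.\<close>

lemma compact_coordinatewise:
  fixes S :: "'i \<Rightarrow> 'b::topological_space set"
  assumes "\<And>x. compact (S x)"
  shows "compact {f. \<forall>x. f x \<in> S x}"
proof -
  have "compactin (product_topology (\<lambda>_. euclidean) UNIV) (PiE UNIV S)"
    using assms by (simp add: compactin_PiE)
  moreover have "PiE UNIV S = {f. \<forall>x. f x \<in> S x}"
    by (auto simp: PiE_def)
  ultimately show ?thesis
    by (simp add: euclidean_product_topology)
qed

lemma continuous_on_entry2: "continuous_on S (\<lambda>\<pi> :: 'a \<Rightarrow> 'b \<Rightarrow> 'c::topological_space. \<pi> i j)"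
proof -
  have "continuous_on S (\<lambda>\<pi> :: 'a \<Rightarrow> 'b \<Rightarrow> 'c. \<pi> i)"
    by (rule continuous_on_product_then_coordinatewise[OF continuous_on_id])
  then show ?thesis
    by (rule continuous_on_product_then_coordinatewise)
qed

lemma continuous_on_entry3: "continuous_on S (\<lambda>\<pi> :: 'm \<Rightarrow> 'a \<Rightarrow> 'b \<Rightarrow> 'c::topological_space. \<pi> m i j)"
proof -
  have "continuous_on S (\<lambda>\<pi> :: 'm \<Rightarrow> 'a \<Rightarrow> 'b \<Rightarrow> 'c. \<pi> m i)"
    by (rule continuous_on_entry2)
  then show ?thesis
    by (rule continuous_on_product_then_coordinatewise)
qed

lemma transport_plans_le:
  assumes "finite B" "\<pi> \<in> transport_plans A B p q" "i \<in> A" "j \<in> B"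
  shows "\<pi> i j \<le> q i"
proof -
  have "\<pi> i j \<le> (\<Sum>j\<in>B. \<pi> i j)"
    using assms by (intro member_le_sum) (auto simp: transport_plans_def)
  then show ?thesis
    using assms by (simp add: transport_plans_def)
qed

text \<open>The second marginal inherits its total mass from the first, by exchanging the order of
  summation.\<close>

lemma transport_plan_prob_vector:
  assumes "\<pi> \<in> transport_plans A B p q" "prob_vector A q"
  shows "prob_vector B p"
proof -
  have p: "(\<Sum>i\<in>A. \<pi> i j) = p j" if "j \<in> B" for j
    using assms(1) that by (simp add: transport_plans_def)
  have "(\<Sum>i\<in>A. \<pi> i j) \<ge> 0" if "j \<in> B" for j
    using assms(1) that by (intro sum_nonneg) (simp add: transport_plans_def)
  then have "p j \<ge> 0" if "j \<in> B" for j
    using that by (simp add: p)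
  moreover have "(\<Sum>j\<in>B. p j) = 1"
  proof -
    have "(\<Sum>j\<in>B. p j) = (\<Sum>j\<in>B. \<Sum>i\<in>A. \<pi> i j)"
      by (simp add: p)
    also have "\<dots> = (\<Sum>i\<in>A. \<Sum>j\<in>B. \<pi> i j)"
      by (rule sum.swap)
    also have "\<dots> = 1"
      using assms by (simp add: transport_plans_def prob_vector_def)
    finally show ?thesis .
  qed
  ultimately show ?thesis by (simp add: prob_vector_def)
qed

text \<open>The independent coupling.\<close>

lemma product_transport_plan:
  assumes "prob_vector A q" "prob_vector B p"
  shows "(\<lambda>i j. q i * p j) \<in> transport_plans A B p q"
  using assms
  by (simp add: transport_plans_def prob_vector_def flip: sum_distrib_left sum_distrib_right)

text \<open>The entries of a plan off \<open>A \<times> B\<close> are unconstrained, so the set of all plans is not compact.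
  Setting these entries to 0 changes neither feasibility nor cost, and the plans of this form are a
  closed part of a compact box.\<close>

lemma optimal_transport_plan_exists:
  assumes "finite A" "finite B" "prob_vector A q" "prob_vector B p"
  obtains \<pi> where "\<pi> \<in> transport_plans A B p q"
    and "\<And>\<rho>. \<rho> \<in> transport_plans A B p q \<Longrightarrow>
           (\<Sum>i\<in>A. \<Sum>j\<in>B. c i j * \<pi> i j) \<le> (\<Sum>i\<in>A. \<Sum>j\<in>B. c i j * \<rho> i j)"
proof -
  define S where "S i j = (if i \<in> A \<and> j \<in> B then {0..q i} else {0::real})" for i j
  define K where "K = {\<pi>. \<forall>i. \<pi> i \<in> {\<sigma>. \<forall>j. \<sigma> j \<in> S i j}} \<inter> transport_plans A B p q"
  define cut where "cut \<rho> = (\<lambda>i j. if i \<in> A \<and> j \<in> B then \<rho> i j else 0)" for \<rho> :: "'a \<Rightarrow> 'b \<Rightarrow> real"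
  have "compact {\<pi>. \<forall>i. \<pi> i \<in> {\<sigma>. \<forall>j. \<sigma> j \<in> S i j}}"
    by (intro compact_coordinatewise) (simp add: S_def)
  moreover have "closed (transport_plans A B p q)"
    unfolding transport_plans_def Ball_def
    by (intro closed_Collect_conj closed_Collect_all closed_Collect_imp closed_Collect_le
        closed_Collect_eq open_Collect_const continuous_intros continuous_on_entry2)
  ultimately have compact: "compact K"
    unfolding K_def by (rule compact_Int_closed)
  have cut: "cut \<rho> \<in> K" if "\<rho> \<in> transport_plans A B p q" for \<rho>
    using that transport_plans_le[OF \<open>finite B\<close> that]
    by (auto simp: K_def cut_def S_def transport_plans_def)
  have "K \<noteq> {}"
    using cut[OF product_transport_plan[OF assms(3,4)]] by blast
  moreover have "continuous_on K (\<lambda>\<pi>. \<Sum>i\<in>A. \<Sum>j\<in>B. c i j * \<pi> i j)"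
    by (intro continuous_intros continuous_on_entry2)
  ultimately obtain \<pi> where "\<pi> \<in> K"
    and min: "\<And>\<rho>. \<rho> \<in> K \<Longrightarrow>
      (\<Sum>i\<in>A. \<Sum>j\<in>B. c i j * \<pi> i j) \<le> (\<Sum>i\<in>A. \<Sum>j\<in>B. c i j * \<rho> i j)"
    using continuous_attains_inf[OF compact] by meson
  show thesis
  proof
    show "\<pi> \<in> transport_plans A B p q"
      using \<open>\<pi> \<in> K\<close> by (simp add: K_def)
    show "(\<Sum>i\<in>A. \<Sum>j\<in>B. c i j * \<pi> i j) \<le> (\<Sum>i\<in>A. \<Sum>j\<in>B. c i j * \<rho> i j)"
      if "\<rho> \<in> transport_plans A B p q" for \<rho>
      using min[OF cut[OF that]] by (simp add: cut_def)
  qed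
qed

text \<open>An infimum of reals has a meaning only for nonempty sets that are bounded below. Here it is the
  value of an optimal plan, which yields both of the following facts.\<close>

lemma wasserstein_pow_attained:
  assumes "finite A" "finite B" "prob_vector A q" "prob_vector B p"
  obtains \<pi> where "\<pi> \<in> transport_plans A B p q"
    and "(\<Sum>i\<in>A. \<Sum>j\<in>B. c i j * \<pi> i j) = wasserstein_pow A B c p q"
proof -
  obtain \<pi> where \<pi>: "\<pi> \<in> transport_plans A B p q"
    "\<And>\<rho>. \<rho> \<in> transport_plans A B p q \<Longrightarrow>
      (\<Sum>i\<in>A. \<Sum>j\<in>B. c i j * \<pi> i j) \<le> (\<Sum>i\<in>A. \<Sum>j\<in>B. c i j * \<rho> i j)"
    using optimal_transport_plan_exists[OF assms] by blast
  then have "wasserstein_pow A B c p q = (\<Sum>i\<in>A. \<Sum>j\<in>B. c i j * \<pi> i j)"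
    unfolding wasserstein_pow_def by (intro cInf_eq_minimum) auto
  with \<pi>(1) that show thesis by simp
qed

lemma wasserstein_pow_le:
  assumes "finite A" "finite B" "prob_vector A q" "prob_vector B p"
    and "\<rho> \<in> transport_plans A B p q"
  shows "wasserstein_pow A B c p q \<le> (\<Sum>i\<in>A. \<Sum>j\<in>B. c i j * \<rho> i j)"
proof -
  obtain \<pi> where "\<And>\<rho>. \<rho> \<in> transport_plans A B p q \<Longrightarrow>
      (\<Sum>i\<in>A. \<Sum>j\<in>B. c i j * \<pi> i j) \<le> (\<Sum>i\<in>A. \<Sum>j\<in>B. c i j * \<rho> i j)"
    using optimal_transport_plan_exists[OF assms(1-4)] by blast
  then show ?thesis
    unfolding wasserstein_pow_def
    by (intro cINF_lower[OF bdd_belowI2] assms(5))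
qed

section \<open>The recursive problem as a barycenter problem\<close>

text \<open>The equivalence concerns a single recursion step and does not see the rest of the trees: \<open>M\<close>
  stands for the nodes of one stage of the original tree and \<open>B\<close> for the children of the given node
  of the reduced tree.\<close>

locale recursion_step =
  fixes E :: "('a \<times> 'a) set" and P :: "'a \<Rightarrow> real" and M :: "'a set" and B :: "'b set"
    and c :: "'a \<Rightarrow> 'b \<Rightarrow> real" and \<alpha> :: "'a \<Rightarrow> real"
  assumes finite_M: "finite M" and M_nonempty: "M \<noteq> {}"
    and finite_B: "finite B" and B_nonempty: "B \<noteq> {}"
    and finite_children: "\<And>m. m \<in> M \<Longrightarrow> finite (children E m)"
    and prob_cond: "\<And>m. m \<in> M \<Longrightarrow> prob_vector (children E m) (cond_prob P m)"
    and weight_nonneg: "\<And>m. m \<in> M \<Longrightarrow> \<alpha> m \<ge> 0"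
begin

abbreviation "feasible \<equiv> recursive_feasible E P M B"
abbreviation "rec_obj \<equiv> recursive_objective E M B c \<alpha>"
abbreviation "bary_obj \<equiv> barycenter_objective M (children E) B c \<alpha> (cond_prob P)"

definition common_marginal :: "('a \<Rightarrow> 'a \<Rightarrow> 'b \<Rightarrow> real) \<Rightarrow> ('b \<Rightarrow> real) \<Rightarrow> bool" where
  "common_marginal \<pi> p \<longleftrightarrow> (\<forall>m\<in>M. \<forall>j\<in>B. p j = (\<Sum>i\<in>children E m. \<pi> m i j))"

lemma plans_imp_feasible:
  assumes "\<And>m. m \<in> M \<Longrightarrow> \<pi> m \<in> transport_plans (children E m) B p (cond_prob P m)"
  shows "feasible \<pi>" "common_marginal \<pi> p"
  using assms by (auto simp: recursive_feasible_def transport_plans_def common_marginal_def)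

lemma feasible_imp_plans:
  assumes "feasible \<pi>" "common_marginal \<pi> p" "m \<in> M"
  shows "\<pi> m \<in> transport_plans (children E m) B p (cond_prob P m)"
proof -
  have "\<forall>i\<in>children E m. (\<Sum>j\<in>B. \<pi> m i j) = cond_prob P m i"
    and "\<forall>i\<in>children E m. \<forall>j\<in>B. \<pi> m i j \<ge> 0"
    using assms(1,3) unfolding recursive_feasible_def by blast+
  moreover have "\<forall>j\<in>B. (\<Sum>i\<in>children E m. \<pi> m i j) = p j"
    using assms(2,3) by (simp add: common_marginal_def)
  ultimately show ?thesis by (simp add: transport_plans_def)
qed

lemma prob_common_marginal:
  assumes "feasible \<pi>" "common_marginal \<pi> p"
  shows "prob_vector B p"
proof -
  obtain m where m: "m \<in> M" using M_nonempty by blast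
  show ?thesis
    using transport_plan_prob_vector[OF feasible_imp_plans[OF assms m] prob_cond[OF m]] .
qed

lemma common_marginal_exists:
  assumes "feasible \<pi>"
  obtains p where "common_marginal \<pi> p"
proof -
  obtain m where m: "m \<in> M" using M_nonempty by blast
  have "common_marginal \<pi> (\<lambda>j. \<Sum>i\<in>children E m. \<pi> m i j)"
    using assms m unfolding common_marginal_def recursive_feasible_def by fast
  with that show thesis by blast
qed

text \<open>Feasibility couples the plans of different nodes only through their common marginal.\<close>

lemma recursive_feasible_iff:
  "feasible \<pi> \<longleftrightarrow>
     (\<exists>p. prob_vector B p \<and>
        (\<forall>m\<in>M. \<pi> m \<in> transport_plans (children E m) B p (cond_prob P m)))"
proof
  assume feas: "feasible \<pi>"
  obtain p where "common_marginal \<pi> p"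
    using common_marginal_exists[OF feas] .
  with feas show "\<exists>p. prob_vector B p \<and>
      (\<forall>m\<in>M. \<pi> m \<in> transport_plans (children E m) B p (cond_prob P m))"
    using prob_common_marginal feasible_imp_plans by blast
qed (use plans_imp_feasible(1) in blast)

lemma barycenter_le_recursive:
  assumes "feasible \<pi>" "common_marginal \<pi> p"
  shows "bary_obj p \<le> rec_obj \<pi>"
  unfolding barycenter_objective_def recursive_objective_def
proof (intro sum_mono mult_left_mono weight_nonneg)
  fix m assume m: "m \<in> M"
  show "wasserstein_pow (children E m) B c p (cond_prob P m)
      \<le> (\<Sum>i\<in>children E m. \<Sum>j\<in>B. \<pi> m i j * c i j)"
    using wasserstein_pow_le[OF finite_children[OF m] finite_B prob_cond[OF m]
        prob_common_marginal[OF assms] feasible_imp_plans[OF assms m], of c]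
    by (simp add: mult.commute)
qed

text \<open>Optimal plans may be chosen independently for the nodes of \<open>M\<close>: once \<open>p\<close> is prescribed,
  no constraint relates them.\<close>

lemma barycenter_attained:
  assumes "prob_vector B p"
  obtains \<pi> where "feasible \<pi>" "common_marginal \<pi> p" "rec_obj \<pi> = bary_obj p"
proof -
  have "\<forall>m\<in>M. \<exists>\<rho>. \<rho> \<in> transport_plans (children E m) B p (cond_prob P m) \<and>
      (\<Sum>i\<in>children E m. \<Sum>j\<in>B. c i j * \<rho> i j)
        = wasserstein_pow (children E m) B c p (cond_prob P m)"
    using wasserstein_pow_attained[OF finite_children finite_B prob_cond assms] by metis
  from bchoice[OF this] obtain \<pi> where \<pi>:
    "\<And>m. m \<in> M \<Longrightarrow> \<pi> m \<in> transport_plans (children E m) B p (cond_prob P m)"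
    "\<And>m. m \<in> M \<Longrightarrow> (\<Sum>i\<in>children E m. \<Sum>j\<in>B. c i j * \<pi> m i j)
        = wasserstein_pow (children E m) B c p (cond_prob P m)"
    by blast
  have "rec_obj \<pi> = bary_obj p"
    using \<pi>(2) by (simp add: recursive_objective_def barycenter_objective_def mult.commute)
  with that plans_imp_feasible[OF \<pi>(1)] show thesis by blast
qed

lemma recursive_feasible_exists: "\<exists>\<pi>. feasible \<pi>"
proof -
  have "prob_vector B (\<lambda>_. 1 / card B)"
    using finite_B B_nonempty by (simp add: prob_vector_def)
  then show ?thesis using barycenter_attained by metis
qed

text \<open>Compactness for whole families of plans, as for single plans. The coupling of the
  marginals is a closed condition, too.\<close>

lemma recursive_minimum_exists: "\<exists>\<pi>. is_arg_min rec_obj feasible \<pi>"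
proof -
  define S where "S m i j =
    (if m \<in> M \<and> i \<in> children E m \<and> j \<in> B then {0..cond_prob P m i} else {0::real})" for m i j
  define Q where "Q = {\<pi>. \<forall>m. \<pi> m \<in> {\<rho>. \<forall>i. \<rho> i \<in> {\<sigma>. \<forall>j. \<sigma> j \<in> S m i j}}}"
  define K where "K = Q \<inter> {\<pi>. feasible \<pi>}"
  define cut where "cut \<rho> = (\<lambda>m i j. if m \<in> M \<and> i \<in> children E m \<and> j \<in> B then \<rho> m i j else 0)"
    for \<rho> :: "'a \<Rightarrow> 'a \<Rightarrow> 'b \<Rightarrow> real"
  have "compact Q"
    unfolding Q_def by (intro compact_coordinatewise) (simp add: S_def)
  moreover have "closed {\<pi>. feasible \<pi>}"
    unfolding recursive_feasible_def Ball_def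
    by (intro closed_Collect_conj closed_Collect_all closed_Collect_imp closed_Collect_le
        closed_Collect_eq open_Collect_const continuous_intros continuous_on_entry3)
  ultimately have compact: "compact K"
    unfolding K_def by (rule compact_Int_closed)
  have cut: "cut \<rho> \<in> K" if "feasible \<rho>" for \<rho>
  proof -
    have "\<rho> m i j \<in> S m i j" if "m \<in> M" "i \<in> children E m" "j \<in> B" for m i j
    proof -
      obtain p where p: "\<rho> m \<in> transport_plans (children E m) B p (cond_prob P m)"
        using \<open>feasible \<rho>\<close> \<open>m \<in> M\<close> recursive_feasible_iff by metis
      then show ?thesis
        using transport_plans_le[OF finite_B p that(2,3)] that
        by (simp add: S_def transport_plans_def)
    qed
    then have "cut \<rho> \<in> Q"
      by (simp add: Q_def cut_def) (simp add: S_def)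
    moreover have "feasible (cut \<rho>) \<longleftrightarrow> feasible \<rho>"
      by (simp add: recursive_feasible_def cut_def)
    ultimately show ?thesis
      using \<open>feasible \<rho>\<close> by (simp add: K_def)
  qed
  have "K \<noteq> {}"
    using recursive_feasible_exists cut by blast
  moreover have "continuous_on K rec_obj"
    unfolding recursive_objective_def
    by (intro continuous_intros continuous_on_entry3)
  ultimately have "\<exists>\<pi>\<in>K. \<forall>\<rho>\<in>K. rec_obj \<pi> \<le> rec_obj \<rho>"
    by (rule continuous_attains_inf[OF compact])
  then obtain \<pi> where "\<pi> \<in> K" and min: "\<And>\<rho>. \<rho> \<in> K \<Longrightarrow> rec_obj \<pi> \<le> rec_obj \<rho>"
    by blast
  have "rec_obj \<pi> \<le> rec_obj \<rho>" if "feasible \<rho>" for \<rho>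
    using min[OF cut[OF that]] by (simp add: cut_def recursive_objective_def)
  with \<open>\<pi> \<in> K\<close> show ?thesis
    by (auto simp: K_def is_arg_min_linorder)
qed

text \<open>The value of an optimal family is at most \<open>bary_obj q\<close> for every probability vector \<open>q\<close>, as this
  number is the value of some feasible family, and at least \<open>bary_obj p\<close> for its own marginal
  \<open>p\<close>.\<close>

lemma common_marginal_of_minimum:
  assumes "is_arg_min rec_obj feasible \<pi>" "common_marginal \<pi> p"
  shows "is_arg_min bary_obj (prob_vector B) p" "rec_obj \<pi> = bary_obj p"
proof -
  have feas: "feasible \<pi>"
    using assms(1) by (simp add: is_arg_min_def)
  have le: "rec_obj \<pi> \<le> bary_obj q" if "prob_vector B q" for q
    using barycenter_attained[OF that] assms(1) by (metis is_arg_min_linorder)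
  have prob: "prob_vector B p"
    using prob_common_marginal[OF feas assms(2)] .
  have lower: "bary_obj p \<le> rec_obj \<pi>"
    using barycenter_le_recursive[OF feas assms(2)] .
  show "is_arg_min bary_obj (prob_vector B) p"
    using prob lower le by (fastforce simp: is_arg_min_linorder)
  show "rec_obj \<pi> = bary_obj p"
    using lower le[OF prob] by simp
qed

lemma minima_agree:
  "\<exists>\<pi> p. is_arg_min rec_obj feasible \<pi> \<and> is_arg_min bary_obj (prob_vector B) p \<and>
     rec_obj \<pi> = bary_obj p"
proof -
  obtain \<pi> where \<pi>: "is_arg_min rec_obj feasible \<pi>"
    using recursive_minimum_exists by blast
  then obtain p where "common_marginal \<pi> p"
    using common_marginal_exists by (auto simp: is_arg_min_def)
  with \<pi> show ?thesis
    using common_marginal_of_minimum by blast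
qed

lemma barycenter_iff_common_marginal:
  "is_arg_min bary_obj (prob_vector B) p \<longleftrightarrow>
     (\<exists>\<pi>. is_arg_min rec_obj feasible \<pi> \<and> common_marginal \<pi> p)"
proof
  assume p: "is_arg_min bary_obj (prob_vector B) p"
  then obtain \<pi> where \<pi>: "feasible \<pi>" "common_marginal \<pi> p" "rec_obj \<pi> = bary_obj p"
    using barycenter_attained by (auto simp: is_arg_min_def)
  have "rec_obj \<pi> \<le> rec_obj \<rho>" if "feasible \<rho>" for \<rho>
  proof -
    obtain q where q: "common_marginal \<rho> q"
      using common_marginal_exists[OF \<open>feasible \<rho>\<close>] .
    have "bary_obj p \<le> bary_obj q"
      using p prob_common_marginal[OF that q] by (simp add: is_arg_min_linorder)
    also have "\<dots> \<le> rec_obj \<rho>"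
      using barycenter_le_recursive[OF that q] .
    finally show ?thesis using \<pi>(3) by simp
  qed
  with \<pi> show "\<exists>\<pi>. is_arg_min rec_obj feasible \<pi> \<and> common_marginal \<pi> p"
    by (auto simp: is_arg_min_linorder)
next
  assume "\<exists>\<pi>. is_arg_min rec_obj feasible \<pi> \<and> common_marginal \<pi> p"
  then show "is_arg_min bary_obj (prob_vector B) p"
    using common_marginal_of_minimum(1) by blast
qed

end

section \<open>Stages of a scenario tree\<close>

context rooted_tree
begin

lemma stage_subset: "stage E r t \<subseteq> V"
proof (cases t)
  case 0
  then show ?thesis using root_node by (auto simp: stage_def)
next
  case (Suc k)
  then show ?thesis using edges by (auto simp: stage_def)
qed

lemma children_subset: "children E m \<subseteq> V"
  using edges by (auto simp: children_def)

text \<open>Walking back from a node to its unique parent, two paths from the root to the same node reach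
  the root after equally many steps, since the root has no parent.\<close>

lemma stage_unique: "m \<in> stage E r s \<Longrightarrow> m \<in> stage E r t \<Longrightarrow> s = t"
proof (induction s arbitrary: t m)
  case 0
  then show ?case
    using root_no_parent by (cases t) (auto simp: stage_def)
next
  case (Suc s)
  then obtain x where x: "x \<in> stage E r s" "(x, m) \<in> E"
    by (auto simp: stage_def)
  then have "m \<noteq> r"
    using root_no_parent by blast
  then obtain k y where k: "t = Suc k" and y: "y \<in> stage E r k" "(y, m) \<in> E"
    using Suc.prems(2) by (cases t) (auto simp: stage_def)
  have "x = y"
    using unique_parent[of m] \<open>m \<noteq> r\<close> edges x(2) y(2) by blast
  then show ?case
    using Suc.IH[OF x(1)] y(1) k by simp
qed

end

lemma (in depth_tree) children_nonempty:
  assumes "t < T" "m \<in> stage E r t"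
  shows "children E m \<noteq> {}"
  using assms leaf_iff[of m] stage_subset stage_unique by blast

text \<open>A stage-\<open>T\<close> node exists since the leaf probabilities do not add up to 0; the path to it
  meets every earlier stage.\<close>

lemma (in scenario_tree) stage_nonempty:
  assumes "t \<le> T"
  shows "stage E r t \<noteq> {}"
proof -
  have "stage E r T \<noteq> {}"
    using prob_leaves by force
  then obtain l where "(r, l) \<in> E ^^ (t + (T - t))"
    using assms by (auto simp: stage_def)
  then show ?thesis
    by (auto simp: stage_def relpow_add)
qed

lemma (in scenario_tree) prob_vector_cond_prob:
  assumes "t < T" "m \<in> stage E r t"
  shows "prob_vector (children E m) (cond_prob P m)"
proof -
  have m: "m \<in> V" using assms(2) stage_subset by blast
  have "(\<Sum>i\<in>children E m. cond_prob P m i) = P m / P m"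
    using prob_children[OF m children_nonempty[OF assms]]
    by (simp add: cond_prob_def flip: sum_divide_distrib)
  moreover have "cond_prob P m i \<ge> 0" if "i \<in> children E m" for i
    using prob_pos[OF m] prob_pos[of i] that children_subset
    by (force simp: cond_prob_def)
  ultimately show ?thesis
    using prob_pos[OF m] by (simp add: prob_vector_def)
qed

theorem proposition1:
  fixes N :: "'a set" and E :: "('a \<times> 'a) set" and r :: 'a and P :: "'a \<Rightarrow> real"
    and N' :: "'b set" and E' :: "('b \<times> 'b) set" and r' :: 'b
    and T t :: nat and n :: 'b
    and d :: "'a \<Rightarrow> 'b \<Rightarrow> real" and \<iota> :: real
    and \<kappa> :: "'a \<Rightarrow> 'b \<Rightarrow> 'a \<Rightarrow> 'b \<Rightarrow> real"
    and mass :: "'a \<Rightarrow> 'b \<Rightarrow> real"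
    and \<delta> :: "'a \<Rightarrow> 'b \<Rightarrow> real" and \<alpha> :: "'a \<Rightarrow> real"
  defines "\<delta> \<equiv> node_cost E E' d \<iota> \<kappa> (T - Suc t)"
    and "\<alpha> \<equiv> \<lambda>m. mass m n"
  assumes "scenario_tree N E r T P"
    and "depth_tree N' E' r' T"
    and "\<iota> \<ge> 1"
    and "\<And>i j. i \<in> stage E r T \<Longrightarrow> j \<in> stage E' r' T \<Longrightarrow> d i j \<ge> 0"
    and "\<And>s u v i j. t < s \<Longrightarrow> s < T \<Longrightarrow> u \<in> stage E r s \<Longrightarrow> v \<in> stage E' r' s \<Longrightarrow>
           i \<in> children E u \<Longrightarrow> j \<in> children E' v \<Longrightarrow> \<kappa> u v i j \<ge> 0"
    and "t < T" and "n \<in> stage E' r' t"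
    and "\<And>m. m \<in> stage E r t \<Longrightarrow> mass m n \<ge> 0"
  shows "(\<exists>\<pi> p.
           is_arg_min (recursive_objective E (stage E r t) (children E' n) \<delta> \<alpha>)
             (recursive_feasible E P (stage E r t) (children E' n)) \<pi> \<and>
           is_arg_min (barycenter_objective (stage E r t) (children E) (children E' n) \<delta> \<alpha> (cond_prob P))
             (prob_vector (children E' n)) p \<and>
           recursive_objective E (stage E r t) (children E' n) \<delta> \<alpha> \<pi> =
             barycenter_objective (stage E r t) (children E) (children E' n) \<delta> \<alpha> (cond_prob P) p)
       \<and> (\<forall>p. prob_vector (children E' n) p \<longrightarrow>
           (is_arg_min (barycenter_objective (stage E r t) (children E) (children E' n) \<delta> \<alpha> (cond_prob P))
              (prob_vector (children E' n)) p \<longleftrightarrow>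
            (\<exists>\<pi>. is_arg_min (recursive_objective E (stage E r t) (children E' n) \<delta> \<alpha>)
                    (recursive_feasible E P (stage E r t) (children E' n)) \<pi> \<and>
                  (\<forall>m\<in>stage E r t. \<forall>j\<in>children E' n. p j = (\<Sum>i\<in>children E m. \<pi> m i j)))))"
proof -
  interpret orig: scenario_tree N E r T P by fact
  interpret red: depth_tree N' E' r' T by fact
  interpret step: recursion_step E P "stage E r t" "children E' n" \<delta> \<alpha>
  proof
    show "finite (stage E r t)"
      using orig.stage_subset orig.finite_nodes by (rule finite_subset)
    show "stage E r t \<noteq> {}"
      using orig.stage_nonempty \<open>t < T\<close> by simp
    show "finite (children E' n)"
      using red.children_subset red.finite_nodes by (rule finite_subset)
    show "children E' n \<noteq> {}"
      using red.children_nonempty \<open>t < T\<close> \<open>n \<in> stage E' r' t\<close> .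
    show "finite (children E m)" for m
      using orig.children_subset orig.finite_nodes by (rule finite_subset)
    show "prob_vector (children E m) (cond_prob P m)" if "m \<in> stage E r t" for m
      using orig.prob_vector_cond_prob \<open>t < T\<close> that .
    show "\<alpha> m \<ge> 0" if "m \<in> stage E r t" for m
      using that assms(10) by (simp add: \<alpha>_def)
  qed
  show ?thesis
    using step.minima_agree step.barycenter_iff_common_marginal
    unfolding step.common_marginal_def by blast
qed

end
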